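(* Let $\mathcal{A}\in\mathbb{H}^{I_{1}\times \cdots \times I_{N}\times J_{1}\times \cdots \times J_{N}}$, let $r=\operatorname{rank}(f(\mathcal{A}))$, and let the SVD of $\mathcal{A}$ be $$\mathcal{A}=\mathcal{U}*_{N}\mathcal{B}*_{N}\mathcal{V}^{*},$$ where $\mathcal{U}\in\mathbb{H}^{I_{1}\times \cdots \times I_{N}\times I_{1}\times \cdots \times I_{N}}$ and $\mathcal{V}\in\mathbb{H}^{J_{1}\times \cdots \times J_{N}\times J_{1}\times \cdots \times J_{N}}$ are unitary tensors and $\mathcal{B}\in\mathbb{R}^{I_{1}\times \cdots \times I_{N}\times J_{1}\times \cdots \times J_{N}}$ is given by $$\mathcal{B}_{i_{1}\cdots i_{N}j_{1}\cdots j_{N}}=\begin{cases} d_{i}, & \text{if } (i_{1},\ldots,i_{N},j_{1},\ldots,j_{N})=(p_{1}^{i},\ldots,p_{N}^{i},q_{1}^{i},\ldots,q_{N}^{i}) \text{ for some } i\in\{1,\ldots,r\},\\ 0, & \text{otherwise,}\end{cases}$$ with $d_1,\ldots,d_r$ the positive singular values of the quaternion matrix $f(\mathcal{A})$ and, for $i=1,\ldots,r$, $$p_{t}^{i}=\left[\frac{i-1-\sum_{k=t+1}^{N}(p_{k}^{i}-1)\prod_{s=1}^{k-1}I_{s}}{\prod_{s=1}^{t-1}I_{s}}\right]+1\quad (t=N,N-1,\ldots,2),\qquad p_{1}^{i}=i-\sum_{k=2}^{N}(p_{k}^{i}-1)\prod_{s=1}^{k-1}I_{s},$$ $$q_{t}^{i}=\left[\frac{i-1-\sum_{k=t+1}^{N}(q_{k}^{i}-1)\prod_{s=1}^{k-1}J_{s}}{\prod_{s=1}^{t-1}J_{s}}\right]+1\quad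 (t=N,N-1,\ldots,2),\qquad q_{1}^{i}=i-\sum_{k=2}^{N}(q_{k}^{i}-1)\prod_{s=1}^{k-1}J_{s},$$ where $[a]$ is the largest integer less than or equal to $a$. Then the Moore-Penrose inverse $\mathcal{A}^{\dag}$ of $\mathcal{A}$ exists and is unique, and $$\mathcal{A}^{\dag}=\mathcal{V}*_{N}\mathcal{B}^{\dag}*_{N}\mathcal{U}^{*},$$ where the tensor $\mathcal{B}^{\dag}\in\mathbb{R}^{J_{1}\times \cdots \times J_{N}\times I_{1}\times \cdots \times I_{N}}$ has the structure $$\mathcal{B}^{\dag}_{j_{1}\cdots j_{N}i_{1}\cdots i_{N}}=\begin{cases} d_{i}^{-1}, & \text{if } (j_{1},\ldots,j_{N},i_{1},\ldots,i_{N})=(q_{1}^{i},\ldots,q_{N}^{i},p_{1}^{i},\ldots,p_{N}^{i}) \text{ for some } i\in\{1,\ldots,r\},\\ 0, & \text{otherwise.}\end{cases}$$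
   Context: $\mathbb{H}$ is the real quaternion algebra $\{q_0+q_1\mathbf{i}+q_2\mathbf{j}+q_3\mathbf{k}: q_0,\ldots,q_3\in\mathbb{R}\}$ with $\mathbf{i}^2=\mathbf{j}^2=\mathbf{k}^2=\mathbf{ijk}=-1$, and $\bar q=q_0-q_1\mathbf{i}-q_2\mathbf{j}-q_3\mathbf{k}$. $\mathbb{H}^{I_1\times\cdots\times I_N}$ (resp. $\mathbb{R}^{I_1\times\cdots\times I_N}$) is the set of order $N$ arrays $(a_{i_1\cdots i_N})_{1\le i_j\le I_j}$ with quaternion (resp. real) entries. Einstein product: for $\mathcal{A}\in\mathbb{H}^{I_{1}\times \cdots \times I_{N}\times J_{1}\times \cdots \times J_{N}}$ and $\mathcal{B}\in\mathbb{H}^{J_{1}\times \cdots \times J_{N}\times K_{1}\times \cdots \times K_{M}}$, $\mathcal{A}*_N\mathcal{B}\in\mathbb{H}^{I_{1}\times \cdots \times I_{N}\times K_{1}\times \cdots \times K_{M}}$ is given by $(\mathcal{A}*_{N}\mathcal{B})_{i_{1}\cdots i_{N}k_{1}\cdots k_{M}}=\sum_{j_{1}\cdots j_{N}}a_{i_{1}\cdots i_{N}j_{1}\cdots j_{N}}b_{j_{1}\cdots j_{N}k_{1}\cdots k_{M}}$. Conjugate transpose: $(\mathcal{A}^* )_{j_1\cdots j_Ni_1\cdots i_N}=\overline{a_{i_1\cdots i_Nj_1\cdots j_N}}$. The unit tensor $\mathcal{I}$ has entry $1$ at positions $(i_1,\ldots,i_N,i_1,\ldots,i_N)$ and $0$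 elsewhere. $\mathcal{U}$ (square) is unitary if $\mathcal{U}*_N\mathcal{U}^*=\mathcal{U}^**_N\mathcal{U}=\mathcal{I}$. Transformation $f$: for $\mathcal{A}\in\mathbb{H}^{I_{1}\times \cdots \times I_{N}\times J_{1}\times \cdots \times J_{N}}$, $f(\mathcal{A})$ is the quaternion matrix of size $(I_1\cdots I_N)\times(J_1\cdots J_N)$ whose entry in row $i_{1}+\sum_{k=2}^{N}(i_{k}-1)\prod_{s=1}^{k-1}I_{s}$ and column $j_{1}+\sum_{k=2}^{N}(j_{k}-1)\prod_{s=1}^{k-1}J_{s}$ is $a_{i_1\cdots i_Nj_1\cdots j_N}$. The positive singular values of a quaternion matrix $A$ of rank $r$ are the positive reals $d_1,\ldots,d_r$ (with multiplicity) in a decomposition $A=U\begin{pmatrix}D_r&0\\0&0\end{pmatrix}V^*$ with $U,V$ unitary and $D_r=\mathrm{diag}(d_1,\ldots,d_r)$. Moore-Penrose inverse: for $\mathcal{A}\in\mathbb{H}^{I_{1}\times \cdots \times I_{N}\times J_{1}\times \cdots \times J_{N}}$, a tensor $\mathcal{X}\in\mathbb{H}^{J_{1}\times \cdots \times J_{N}\times I_{1}\times \cdots \times I_{N}}$ satisfying (1) $\mathcal{A}*_{N}\mathcal{X}*_{N}\mathcal{A}=\mathcal{A}$; (2) $\mathcal{X}*_{N}\mathcal{A}*_{N}\mathcal{X}=\mathcal{X}$; (3) $(\mathcal{A}*_{N}\mathcal{X})^{*}=\mathcal{A}*_{N}\mathcal{X}$; (4) $(\mathcal{X}*_{N}\mathcal{A})^{*}=\mathcal{X}*_{N}\mathcal{A}$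 is called the Moore-Penrose inverse of $\mathcal{A}$, denoted $\mathcal{A}^{\dag}$. *)

theory Defs
  imports Complex_Main "HOL-Library.FuncSet" "Jordan_Normal_Form.Matrix"
begin

section \<open>Real quaternions\<close>

datatype quat = Quat (qre: real) (qi: real) (qj: real) (qk: real)

lemma quat_eq_iff: "p = q \<longleftrightarrow> qre p = qre q \<and> qi p = qi q \<and> qj p = qj q \<and> qk p = qk q"
  by (auto intro: quat.expand)

instantiation quat :: "{ring_1, real_algebra_1}"
begin

definition "0 = Quat 0 0 0 0"
definition "1 = Quat 1 0 0 0"
definition "p + q = Quat (qre p + qre q) (qi p + qi q) (qj p + qj q) (qk p + qk q)"
definition "- p = Quat (- qre p) (- qi p) (- qj p) (- qk p)"
definition "p - q = Quat (qre p - qre q) (qi p - qi q) (qj p - qj q) (qk p - qk q)"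
definition "p * q = Quat
  (qre p * qre q - qi p * qi q - qj p * qj q - qk p * qk q)
  (qre p * qi q + qi p * qre q + qj p * qk q - qk p * qj q)
  (qre p * qj q - qi p * qk q + qj p * qre q + qk p * qi q)
  (qre p * qk q + qi p * qj q - qj p * qi q + qk p * qre q)"
definition "scaleR c p = Quat (c * qre p) (c * qi p) (c * qj p) (c * qk p)"

instance
  by standard
    (simp_all add: quat_eq_iff zero_quat_def one_quat_def plus_quat_def uminus_quat_def
      minus_quat_def times_quat_def scaleR_quat_def algebra_simps)

end

lemma quat_units:
  "Quat 0 1 0 0 * Quat 0 1 0 0 = - 1"
  "Quat 0 0 1 0 * Quat 0 0 1 0 = - 1"
  "Quat 0 0 0 1 * Quat 0 0 0 1 = - 1"
  "Quat 0 1 0 0 * Quat 0 0 1 0 * Quat 0 0 0 1 = - 1"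
  by (simp_all add: one_quat_def uminus_quat_def times_quat_def)

lemma of_real_quat: "of_real c = Quat c 0 0 0"
  by (simp add: of_real_def scaleR_quat_def one_quat_def)

definition qcnj :: "quat \<Rightarrow> quat" where
  "qcnj p = Quat (qre p) (- qi p) (- qj p) (- qk p)"


section \<open>Quaternion matrices\<close>

definition mat_ctrans :: "quat mat \<Rightarrow> quat mat" where
  "mat_ctrans A = mat (dim_col A) (dim_row A) (\<lambda>(i, j). qcnj (A $$ (j, i)))"

definition mat_unitary :: "nat \<Rightarrow> quat mat \<Rightarrow> bool" where
  "mat_unitary n U \<longleftrightarrow> U \<in> carrier_mat n n \<and>
     U * mat_ctrans U = 1\<^sub>m n \<and> mat_ctrans U * U = 1\<^sub>m n"

text \<open>The rank over the skew field of quaternions is the maximal number of columns that are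
  linearly independent in the right vector space of column vectors, so the scalars \<open>c j\<close>
  stand on the right.\<close>

definition cols_right_indep :: "quat mat \<Rightarrow> nat set \<Rightarrow> bool" where
  "cols_right_indep A S \<longleftrightarrow>
     (\<forall>c. (\<forall>i<dim_row A. (\<Sum>j\<in>S. A $$ (i, j) * c j) = 0) \<longrightarrow> (\<forall>j\<in>S. c j = 0))"

definition quat_rank :: "quat mat \<Rightarrow> nat" where
  "quat_rank A = Max (card ` {S. S \<subseteq> {..<dim_col A} \<and> cols_right_indep A S})"

text \<open>The numbers \<open>d 1, \<dots>, d r\<close>, in any order and with multiplicity, are the positive
  singular values of \<open>A\<close>, where \<open>r\<close> is the rank of \<open>A\<close>.
  The values of \<open>d\<close> at other arguments are irrelevant. The bounds on \<open>r\<close> always hold for the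
  rank; they are spelled out because subtraction on \<^typ>\<open>nat\<close> truncates.\<close>

definition positive_singular_values :: "quat mat \<Rightarrow> (nat \<Rightarrow> real) \<Rightarrow> bool" where
  "positive_singular_values A d \<longleftrightarrow>
     (let m = dim_row A; n = dim_col A; r = quat_rank A in
        r \<le> m \<and> r \<le> n \<and> (\<forall>i\<in>{1..r}. d i > 0) \<and>
        (\<exists>U V. mat_unitary m U \<and> mat_unitary n V \<and>
           A = U * four_block_mat
                     (mat_diag r (\<lambda>i. of_real (d (Suc i)))) (0\<^sub>m r (n - r))
                     (0\<^sub>m (m - r) r) (0\<^sub>m (m - r) (n - r))
                 * mat_ctrans V))"


section \<open>Quaternion tensors\<close>

text \<open>A tensor with dimension list \<open>ds = [I\<^sub>1, \<dots>, I\<^sub>N]\<close> is a function on multi-indices, which are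
  lists \<open>[i\<^sub>1, \<dots>, i\<^sub>N]\<close> counted from 1; it is \<^const>\<open>undefined\<close> elsewhere, so that equality
  of tensors is equality of functions. A tensor in \<open>tensors (ds @ es)\<close> has the entries
  \<open>A (xs @ ys)\<close> for \<open>xs \<in> indices ds\<close> and \<open>ys \<in> indices es\<close>.\<close>

definition indices :: "nat list \<Rightarrow> nat list set" where
  "indices ds = {xs. length xs = length ds \<and> (\<forall>k<length ds. 1 \<le> xs ! k \<and> xs ! k \<le> ds ! k)}"

definition tensors :: "nat list \<Rightarrow> (nat list \<Rightarrow> quat) set" where
  "tensors ds = indices ds \<rightarrow>\<^sub>E UNIV"

text \<open>In \<open>einstein I J K A B\<close>, the factors lie in \<open>tensors (I @ J)\<close> and \<open>tensors (J @ K)\<close>.\<close>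

definition einstein ::
  "nat list \<Rightarrow> nat list \<Rightarrow> nat list \<Rightarrow> (nat list \<Rightarrow> quat) \<Rightarrow> (nat list \<Rightarrow> quat) \<Rightarrow> nat list \<Rightarrow> quat" where
  "einstein I J K A B =
     (\<lambda>x\<in>indices (I @ K). \<Sum>y\<in>indices J.
        A (take (length I) x @ y) * B (y @ drop (length I) x))"

text \<open>\<open>ctrans I J\<close> maps \<open>tensors (I @ J)\<close> to \<open>tensors (J @ I)\<close>.\<close>

definition ctrans :: "nat list \<Rightarrow> nat list \<Rightarrow> (nat list \<Rightarrow> quat) \<Rightarrow> nat list \<Rightarrow> quat" where
  "ctrans I J A =
     (\<lambda>x\<in>indices (J @ I). qcnj (A (drop (length J) x @ take (length J) x)))"

definition unit_tensor :: "nat list \<Rightarrow> nat list \<Rightarrow> quat" where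
  "unit_tensor I =
     (\<lambda>x\<in>indices (I @ I). if take (length I) x = drop (length I) x then 1 else 0)"

definition unitary_tensor :: "nat list \<Rightarrow> (nat list \<Rightarrow> quat) \<Rightarrow> bool" where
  "unitary_tensor I U \<longleftrightarrow> U \<in> tensors (I @ I) \<and>
     einstein I I I U (ctrans I I U) = unit_tensor I \<and>
     einstein I I I (ctrans I I U) U = unit_tensor I"

definition is_moore_penrose ::
  "nat list \<Rightarrow> nat list \<Rightarrow> (nat list \<Rightarrow> quat) \<Rightarrow> (nat list \<Rightarrow> quat) \<Rightarrow> bool" where
  "is_moore_penrose I J A X \<longleftrightarrow> X \<in> tensors (J @ I) \<and>
     einstein I I J (einstein I J I A X) A = A \<and>
     einstein J J I (einstein J I J X A) X = X \<and>
     ctrans I I (einstein I J I A X) = einstein I J I A X \<and>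
     ctrans J J (einstein J I J X A) = einstein J I J X A"

definition moore_penrose :: "nat list \<Rightarrow> nat list \<Rightarrow> (nat list \<Rightarrow> quat) \<Rightarrow> nat list \<Rightarrow> quat" where
  "moore_penrose I J A = (THE X. is_moore_penrose I J A X)"


section \<open>Matrix unfolding\<close>

definition flat_index :: "nat list \<Rightarrow> nat list \<Rightarrow> nat" where
  "flat_index ds xs =
     xs ! 0 + (\<Sum>k=2..length ds. (xs ! (k - 1) - 1) * (\<Prod>s=1..k - 1. ds ! (s - 1)))"

text \<open>Matrix positions are counted from 0, whereas \<^const>\<open>flat_index\<close> counts from 1.\<close>

definition unfold_tensor :: "nat list \<Rightarrow> nat list \<Rightarrow> (nat list \<Rightarrow> quat) \<Rightarrow> quat mat" where
  "unfold_tensor I J A = mat (prod_list I) (prod_list J)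
     (\<lambda>(r, c). A (inv_into (indices I) (flat_index I) (Suc r) @
                  inv_into (indices J) (flat_index J) (Suc c)))"

lemma flat_index_Cons_Cons:
  assumes "xs \<in> indices ds" "ds \<noteq> []" "1 \<le> x"
  shows "flat_index (d # ds) (x # xs) = x + d * (flat_index ds xs - 1)"
proof -
  let ?g = "\<lambda>k. (xs ! (k - 1) - 1) * (\<Prod>s=1..k - 1. ds ! (s - 1))"
  have pr: "(\<Prod>s=1..k. (d # ds) ! (s - 1)) = d * (\<Prod>s=1..k - 1. ds ! (s - 1))"
    if k: "1 \<le> k" for k
  proof -
    obtain j where j: "k = Suc j" using k by (cases k) auto
    show ?thesis unfolding j by (induction j) (simp_all add: prod.cl_ivl_Suc mult.assoc)
  qed
  have "(\<Sum>k=2..length (d # ds). ((x # xs) ! (k - 1) - 1) * (\<Prod>s=1..k - 1. (d # ds) ! (s - 1)))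
      = (\<Sum>k=1..length ds. ((x # xs) ! k - 1) * (\<Prod>s=1..k. (d # ds) ! (s - 1)))"
    using sum.shift_bounds_cl_Suc_ivl
      [of "\<lambda>k. ((x # xs) ! (k - 1) - 1) * (\<Prod>s=1..k - 1. (d # ds) ! (s - 1))" 1 "length ds"]
    by (simp add: numeral_2_eq_2)
  also have "\<dots> = (\<Sum>k=1..length ds. d * ?g k)"
  proof (rule sum.cong)
    fix k assume "k \<in> {1..length ds}"
    then have k: "1 \<le> k" by simp
    then have "(x # xs) ! k = xs ! (k - 1)" by (simp add: nth_Cons')
    then show "((x # xs) ! k - 1) * (\<Prod>s=1..k. (d # ds) ! (s - 1)) = d * ?g k"
      unfolding pr[OF k] by simp
  qed simp
  also have "\<dots> = d * (xs ! 0 - 1 + (\<Sum>k=2..length ds. ?g k))"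
    using assms(2) sum.atLeast_Suc_atMost[of 1 "length ds" ?g]
    by (simp add: sum_distrib_left[symmetric] numeral_2_eq_2 Suc_le_eq)
  also have "xs ! 0 - 1 + (\<Sum>k=2..length ds. ?g k) = flat_index ds xs - 1"
    using assms(1,2) by (auto simp: flat_index_def indices_def)
  finally show ?thesis by (simp add: flat_index_def)
qed

lemma flat_index_range:
  assumes "xs \<in> indices ds" "ds \<noteq> []"
  shows "1 \<le> flat_index ds xs \<and> flat_index ds xs \<le> prod_list ds"
  using assms
proof (induction ds arbitrary: xs)
  case (Cons d ds)
  then obtain x ys where xs: "xs = x # ys" by (cases xs) (auto simp: indices_def)
  have x: "1 \<le> x" "x \<le> d" and ys: "ys \<in> indices ds"
    using Cons.prems(1) by (auto simp: xs indices_def)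
  show ?case
  proof (cases "ds = []")
    case True
    then show ?thesis using x by (simp add: xs flat_index_def)
  next
    case False
    have b: "1 \<le> flat_index ds ys" "flat_index ds ys \<le> prod_list ds"
      using Cons.IH[OF ys False] by auto
    then have "d + d * (flat_index ds ys - 1) \<le> d * prod_list ds"
      by (metis add.commute le_add_diff_inverse2 mult.commute mult_Suc_right mult_le_mono2
          plus_1_eq_Suc)
    then show ?thesis using x flat_index_Cons_Cons[OF ys False x(1), of d] by (simp add: xs)
  qed
qed simp

lemma inj_on_flat_index:
  assumes "ds \<noteq> []"
  shows "inj_on (flat_index ds) (indices ds)"
  using assms
proof (induction ds)
  case (Cons d ds)
  show ?case
  proof (rule inj_onI)
    fix u v
    assume u: "u \<in> indices (d # ds)" and v: "v \<in> indices (d # ds)"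
      and eq: "flat_index (d # ds) u = flat_index (d # ds) v"
    obtain x xs where ux: "u = x # xs" using u by (cases u) (auto simp: indices_def)
    obtain y ys where vy: "v = y # ys" using v by (cases v) (auto simp: indices_def)
    have x: "1 \<le> x" "x \<le> d" "xs \<in> indices ds" using u by (auto simp: ux indices_def)
    have y: "1 \<le> y" "y \<le> d" "ys \<in> indices ds" using v by (auto simp: vy indices_def)
    show "u = v"
    proof (cases "ds = []")
      case True
      then show ?thesis using eq x y by (simp add: ux vy flat_index_def indices_def)
    next
      case False
      have "x - 1 + d * (flat_index ds xs - 1) = y - 1 + d * (flat_index ds ys - 1)"
        using eq flat_index_Cons_Cons[OF x(3) False x(1), of d]
          flat_index_Cons_Cons[OF y(3) False y(1), of d] x(1) y(1)
        by (simp add: ux vy)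
      then have "(x - 1 + d * (flat_index ds xs - 1)) div d = (y - 1 + d * (flat_index ds ys - 1)) div d"
        and "(x - 1 + d * (flat_index ds xs - 1)) mod d = (y - 1 + d * (flat_index ds ys - 1)) mod d"
        by simp_all
      moreover have "x - 1 < d" "y - 1 < d" using x y by auto
      ultimately have "flat_index ds xs - 1 = flat_index ds ys - 1" "x - 1 = y - 1"
        by auto
      then have "x = y" "flat_index ds xs = flat_index ds ys"
        using x y flat_index_range[OF x(3) False] flat_index_range[OF y(3) False] by auto
      then show ?thesis using Cons.IH[OF False] x(3) y(3) by (auto simp: ux vy dest: inj_onD)
    qed
  qed
qed simp

lemma unfold_tensor_entry:
  assumes "xs \<in> indices I" "ys \<in> indices J" "I \<noteq> []" "J \<noteq> []"
  shows "unfold_tensor I J A $$ (flat_index I xs - 1, flat_index J ys - 1) = A (xs @ ys)"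
proof -
  have "flat_index I xs - 1 < prod_list I" "Suc (flat_index I xs - 1) = flat_index I xs"
    "flat_index J ys - 1 < prod_list J" "Suc (flat_index J ys - 1) = flat_index J ys"
    using flat_index_range[OF assms(1,3)] flat_index_range[OF assms(2,4)] by linarith+
  then show ?thesis
    by (simp add: unfold_tensor_def inv_into_f_f[OF inj_on_flat_index[OF assms(3)] assms(1)]
        inv_into_f_f[OF inj_on_flat_index[OF assms(4)] assms(2)] del: One_nat_def)
qed


section \<open>Diagonal positions\<close>

text \<open>\<open>diag_pos ds i t\<close> is the component \<open>p\<^sub>t\<^sup>i\<close> of the multi-index \<open>p\<^sup>i\<close> for the dimensions
  \<open>ds\<close>, where \<open>1 \<le> t \<le> length ds\<close>. It is computed with integers, on which \<open>div\<close> is the floor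
  of the quotient and subtraction does not truncate.\<close>

function diag_pos :: "nat list \<Rightarrow> nat \<Rightarrow> nat \<Rightarrow> int" where
  "diag_pos ds i t =
     (let u = (\<Sum>k=t + 1..length ds. (diag_pos ds i k - 1) * (\<Prod>s=1..k - 1. int (ds ! (s - 1))))
      in if t = 1 then int i - u
         else (int i - 1 - u) div (\<Prod>s=1..t - 1. int (ds ! (s - 1))) + 1)"
  by pat_completeness auto
termination
  by (relation "measure (\<lambda>(ds, i, t). length ds + 1 - t)") auto

declare diag_pos.simps [simp del]

definition diag_index :: "nat list \<Rightarrow> nat \<Rightarrow> nat list" where
  "diag_index ds i = map (\<lambda>t. nat (diag_pos ds i t)) [1..<Suc (length ds)]"

text \<open>\<open>B\<close> is the real tensor in \<open>tensors (I @ J)\<close> with entry \<open>d i\<close> at position \<open>(p\<^sup>i, q\<^sup>i)\<close> for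
  \<open>i = 1, \<dots>, r\<close> and with all other entries 0.\<close>

definition is_diag_tensor ::
  "nat list \<Rightarrow> nat list \<Rightarrow> nat \<Rightarrow> (nat \<Rightarrow> real) \<Rightarrow> (nat list \<Rightarrow> quat) \<Rightarrow> bool" where
  "is_diag_tensor I J r d B \<longleftrightarrow> B \<in> tensors (I @ J) \<and>
     (\<forall>i\<in>{1..r}. B (diag_index I i @ diag_index J i) = of_real (d i)) \<and>
     (\<forall>x\<in>indices (I @ J). (\<forall>i\<in>{1..r}. x \<noteq> diag_index I i @ diag_index J i) \<longrightarrow> B x = 0)"

end

(* Associativity of the Einstein product reduces the claim to the diagonal tensor: if Y is a
   Moore-Penrose inverse of B, then V * Y * U^* is one of U * B * V^*, and the usual computation
   shows that there is at most one. The positions (p^i, q^i) are distinct in each component, because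
   p^i is the multi-index that flat_index sends to i. So diagonal tensors multiply entrywise, and
   inverting the nonzero entries gives the Moore-Penrose inverse of B. *)

theory Submission
  imports Defs
begin

section \<open>Quaternion conjugation\<close>

lemma qcnj_simps [simp]:
  "qcnj 0 = 0" "qcnj (of_real c) = of_real c" "qcnj (qcnj p) = p" "qcnj (p * q) = qcnj q * qcnj p"
  by (auto simp: qcnj_def quat_eq_iff of_real_quat zero_quat_def times_quat_def algebra_simps)

lemma qcnj_add: "qcnj (p + q) = qcnj p + qcnj q"
  by (simp add: qcnj_def quat_eq_iff plus_quat_def)

lemma qcnj_sum: "qcnj (sum f S) = (\<Sum>x\<in>S. qcnj (f x))"
  by (induction S rule: infinite_finite_induct) (simp_all add: qcnj_add)

section \<open>Multi-indices: splitting, finiteness and counting\<close>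

lemma indices_length: "x \<in> indices I \<Longrightarrow> length x = length I"
  by (simp add: indices_def)

lemma Nil_in_indices [simp]: "xs \<in> indices [] \<longleftrightarrow> xs = []"
  by (simp add: indices_def)

lemma Cons_in_indices [simp]: "x # xs \<in> indices (d # ds) \<longleftrightarrow> x \<in> {1..d} \<and> xs \<in> indices ds"
  by (auto simp: indices_def All_less_Suc2)

lemma append_in_indices:
  assumes "length x = length I"
  shows "x @ y \<in> indices (I @ J) \<longleftrightarrow> x \<in> indices I \<and> y \<in> indices J"
  using assms by (induction x I rule: list_induct2) auto

lemma indices_appendE:
  assumes "z \<in> indices (I @ J)"
  obtains x y where "z = x @ y" "x \<in> indices I" "y \<in> indices J"
proof
  have l: "length (take (length I) z) = length I"
    using indices_length[OF assms] by simp
  show "z = take (length I) z @ drop (length I) z" by simp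
  then show "take (length I) z \<in> indices I" "drop (length I) z \<in> indices J"
    using append_in_indices[OF l] assms by metis+
qed

lemma indices_Cons: "indices (d # ds) = case_prod (#) ` ({1..d} \<times> indices ds)"
proof (intro equalityI subsetI)
  fix z assume z: "z \<in> indices (d # ds)"
  then obtain x xs where "z = x # xs"
    using indices_length by (metis length_Suc_conv)
  with z show "z \<in> case_prod (#) ` ({1..d} \<times> indices ds)" by force
qed auto

lemma indices_Nil: "indices [] = {[]}"
  by auto

lemma finite_indices [simp]: "finite (indices ds)"
  by (induction ds) (auto simp: indices_Cons indices_Nil)

lemma card_indices: "card (indices ds) = prod_list ds"
proof (induction ds)
  case (Cons d ds)
  have "inj_on (case_prod (#)) ({1..d} \<times> indices ds)" by (auto simp: inj_on_def)
  then show ?case using Cons by (simp add: indices_Cons card_image card_cartesian_product)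
qed (simp add: indices_Nil)

section \<open>Algebra of the Einstein product and the conjugate transpose\<close>

lemma tensors_eqI:
  assumes "A \<in> tensors (I @ J)" "B \<in> tensors (I @ J)"
    and "\<And>x y. x \<in> indices I \<Longrightarrow> y \<in> indices J \<Longrightarrow> A (x @ y) = B (x @ y)"
  shows "A = B"
  using assms(1,2) unfolding tensors_def
  by (rule PiE_ext) (metis assms(3) indices_appendE)

lemma einstein_in_tensors [simp]: "einstein I J K A B \<in> tensors (I @ K)"
  by (simp add: einstein_def tensors_def)

lemma ctrans_in_tensors [simp]: "ctrans I J A \<in> tensors (J @ I)"
  by (simp add: ctrans_def tensors_def)

lemma unit_tensor_in_tensors [simp]: "unit_tensor I \<in> tensors (I @ I)"
  by (simp add: unit_tensor_def tensors_def)

lemma einstein_entry: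
  assumes "x \<in> indices I" "z \<in> indices K"
  shows "einstein I J K A B (x @ z) = (\<Sum>y\<in>indices J. A (x @ y) * B (y @ z))"
  using assms by (simp add: einstein_def append_in_indices indices_length)

lemma ctrans_entry:
  assumes "x \<in> indices I" "y \<in> indices J"
  shows "ctrans I J A (y @ x) = qcnj (A (x @ y))"
  using assms by (simp add: ctrans_def append_in_indices indices_length)

lemma unit_tensor_entry:
  assumes "x \<in> indices I" "y \<in> indices I"
  shows "unit_tensor I (x @ y) = (if x = y then 1 else 0)"
  using assms by (simp add: unit_tensor_def append_in_indices indices_length)

lemma einstein_assoc:
  "einstein I K L (einstein I J K A B) C = einstein I J L A (einstein J K L B C)"
proof (rule tensors_eqI)
  fix x z assume x: "x \<in> indices I" and z: "z \<in> indices L"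
  have "einstein I K L (einstein I J K A B) C (x @ z)
      = (\<Sum>w\<in>indices K. \<Sum>y\<in>indices J. A (x @ y) * (B (y @ w) * C (w @ z)))"
    using x z by (simp add: einstein_entry sum_distrib_right mult.assoc)
  also have "\<dots> = (\<Sum>y\<in>indices J. \<Sum>w\<in>indices K. A (x @ y) * (B (y @ w) * C (w @ z)))"
    by (rule sum.swap)
  also have "\<dots> = einstein I J L A (einstein J K L B C) (x @ z)"
    using x z by (simp add: einstein_entry sum_distrib_left)
  finally show "einstein I K L (einstein I J K A B) C (x @ z)
    = einstein I J L A (einstein J K L B C) (x @ z)" .
qed simp_all

text \<open>Membership matters here: the product is \<open>undefined\<close> off
  \<open>indices (I @ J)\<close>, so \<open>A\<close> must be too.\<close>

lemma einstein_unit_left: "A \<in> tensors (I @ J) \<Longrightarrow> einstein I I J (unit_tensor I) A = A"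
  by (rule tensors_eqI[where I = I and J = J])
    (simp_all add: einstein_entry unit_tensor_entry if_distrib[of "\<lambda>q. q * _"] cong: if_cong)

text \<open>The factors change places because \<open>qcnj\<close> reverses products of
  quaternions.\<close>

lemma ctrans_einstein:
  "ctrans I K (einstein I J K A B) = einstein K J I (ctrans J K B) (ctrans I J A)"
  by (rule tensors_eqI[where I = K and J = I]) (simp_all add: einstein_entry ctrans_entry qcnj_sum)

lemma ctrans_ctrans: "A \<in> tensors (I @ J) \<Longrightarrow> ctrans J I (ctrans I J A) = A"
  by (rule tensors_eqI[where I = I and J = J]) (simp_all add: ctrans_entry)

text \<open>Bracketed to the right so that it still applies as a rewrite rule after
  \<open>einstein_assoc\<close> has moved all brackets to the right.\<close>

lemma unitary_tensor_cancel:
  assumes "unitary_tensor I U" "A \<in> tensors (I @ J)"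
  shows "einstein I I J (ctrans I I U) (einstein I I J U A) = A"
  using assms by (simp add: einstein_assoc[symmetric] unitary_tensor_def einstein_unit_left)

section \<open>Uniqueness and unitary equivalence of Moore-Penrose inverses\<close>

text \<open>\<open>A X\<close> and \<open>A Y\<close> are self-adjoint, and each absorbs the other
  because A = A X A = A Y A; taking adjoints makes them equal. In the same way X A = Y A, and then X
  = (X A) X = (Y A) X = Y (A Y) = Y.\<close>

lemma moore_penrose_unique:
  assumes X: "is_moore_penrose I J A X" and Y: "is_moore_penrose I J A Y"
  shows "X = Y"
proof -
  let ?AX = "einstein I J I A X" and ?AY = "einstein I J I A Y"
  let ?XA = "einstein J I J X A" and ?YA = "einstein J I J Y A"
  have "?AX = einstein I I I ?AY ?AX"
    using Y by (metis einstein_assoc is_moore_penrose_def)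
  also have "\<dots> = ctrans I I (einstein I I I ?AX ?AY)"
    using X Y by (metis ctrans_einstein is_moore_penrose_def)
  also have "einstein I I I ?AX ?AY = ?AY"
    using X by (metis einstein_assoc is_moore_penrose_def)
  also have "ctrans I I ?AY = ?AY"
    using Y by (simp add: is_moore_penrose_def)
  finally have AX: "?AX = ?AY" .
  have "?XA = einstein J J J ?XA ?YA"
    using Y by (metis einstein_assoc is_moore_penrose_def)
  also have "\<dots> = ctrans J J (einstein J J J ?YA ?XA)"
    using X Y by (metis ctrans_einstein is_moore_penrose_def)
  also have "einstein J J J ?YA ?XA = ?YA"
    using X by (metis einstein_assoc is_moore_penrose_def)
  also have "ctrans J J ?YA = ?YA"
    using Y by (simp add: is_moore_penrose_def)
  finally have XA: "?XA = ?YA" .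
  have "X = einstein J J I ?YA X"
    using X XA by (simp add: is_moore_penrose_def)
  also have "\<dots> = einstein J I I Y ?AY"
    using AX by (simp add: einstein_assoc)
  also have "\<dots> = Y"
    using Y by (simp add: is_moore_penrose_def einstein_assoc)
  finally show ?thesis .
qed

lemma moore_penrose_eqI: "is_moore_penrose I J A X \<Longrightarrow> moore_penrose I J A = X"
  unfolding moore_penrose_def by (blast intro: the_equality moore_penrose_unique)

text \<open>Writing A and X for the two products, the inner factors V^* V cancel in A X and leave U
  (B Y) U^*, while U^* U cancels in X A and leaves V (Y B) V^*. Each Penrose equation for
  \<open>B\<close> then carries over to A.\<close>

lemma is_moore_penrose_unitary_equivalence:
  assumes U: "unitary_tensor I U" and V: "unitary_tensor J V" and Y: "is_moore_penrose I J B Y"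
  shows "is_moore_penrose I J (einstein I J J (einstein I I J U B) (ctrans J J V))
    (einstein J I I (einstein J J I V Y) (ctrans I I U))"
    (is "is_moore_penrose I J ?A ?X")
proof -
  note cancel = unitary_tensor_cancel[OF U] unitary_tensor_cancel[OF V]
  have UU: "ctrans I I (ctrans I I U) = U" and VV: "ctrans J J (ctrans J J V) = V"
    using U V by (simp_all add: unitary_tensor_def ctrans_ctrans)
  have BYB: "einstein I J J B (einstein J I J Y B) = B"
    and YBY: "einstein J I I Y (einstein I J I B Y) = Y"
    and BY: "ctrans I I (einstein I J I B Y) = einstein I J I B Y"
    and YB: "ctrans J J (einstein J I J Y B) = einstein J I J Y B"
    using Y by (simp_all add: is_moore_penrose_def einstein_assoc)
  have AX: "einstein I J I ?A ?X = einstein I I I U (einstein I I I (einstein I J I B Y) (ctrans I I U))"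
    by (simp add: einstein_assoc cancel)
  have XA: "einstein J I J ?X ?A = einstein J J J V (einstein J J J (einstein J I J Y B) (ctrans J J V))"
    by (simp add: einstein_assoc cancel)
  \<comment> \<open>The block B (Y B) is displayed separately so that \<open>BYB\<close> can
    collapse it at the end; \<open>YBY\<close> does the same for Y (B Y) below.\<close>
  have "einstein I I J (einstein I J I ?A ?X) ?A
      = einstein I I J U (einstein I J J (einstein I J J B (einstein J I J Y B)) (ctrans J J V))"
    unfolding AX by (simp add: einstein_assoc cancel)
  moreover have "einstein J J I (einstein J I J ?X ?A) ?X
      = einstein J J I V (einstein J I I (einstein J I I Y (einstein I J I B Y)) (ctrans I I U))"
    unfolding XA by (simp add: einstein_assoc cancel)
  \<comment> \<open>Reversing the factors of U (B Y) U^* gives the same product back, once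
    \<open>UU\<close> restores \<open>U\<close> and \<open>BY\<close> removes the adjoint of the
    middle block.\<close>
  moreover have "ctrans I I (einstein I J I ?A ?X) = einstein I J I ?A ?X"
    unfolding AX by (simp only: ctrans_einstein[of I I] ctrans_einstein[of I I I] UU)
      (simp only: BY einstein_assoc flip: ctrans_einstein)
  moreover have "ctrans J J (einstein J I J ?X ?A) = einstein J I J ?X ?A"
    unfolding XA by (simp only: ctrans_einstein[of J J J] VV)
      (simp only: YB einstein_assoc flip: ctrans_einstein)
  ultimately show ?thesis
    by (simp add: is_moore_penrose_def BYB YBY einstein_assoc)
qed

section \<open>Diagonal positions as inverse of the flattening\<close>

lemma bij_betw_flat_index:
  assumes "ds \<noteq> []"
  shows "bij_betw (flat_index ds) (indices ds) {1..prod_list ds}"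
proof -
  have "flat_index ds ` indices ds = {1..prod_list ds}"
  \<comment> \<open>Surjectivity by counting: an injective image inside a finite set of the same
    cardinality fills it.\<close>
  proof (rule card_subset_eq)
    show "flat_index ds ` indices ds \<subseteq> {1..prod_list ds}"
      using flat_index_range[OF _ assms] by auto
    show "card (flat_index ds ` indices ds) = card {1..prod_list ds}"
      by (simp add: card_image[OF inj_on_flat_index[OF assms]] card_indices)
  qed simp
  then show ?thesis by (simp add: bij_betw_def inj_on_flat_index[OF assms])
qed

text \<open>\<open>flat_index\<close> is a mixed-radix expansion, and the recursion for
  \<open>diag_pos\<close> reads off its digits from the most significant one down. Hence the
  induction on \<open>length ds - t\<close>, with the higher digits already known.\<close>

lemma diag_pos_flat_index:
  assumes xs: "xs \<in> indices ds" and "1 \<le> t" "t \<le> length ds"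
  shows "diag_pos ds (flat_index ds xs) t = int (xs ! (t - 1))"
  using assms(2,3)
proof (induction "length ds - t" arbitrary: t rule: less_induct)
  case (less t)
  \<comment> \<open>\<open>P k\<close> is the place value of the k-th digit and \<open>c k\<close>
    that digit, shifted to start at 0.\<close>
  define P where "P k = (\<Prod>s=1..k - 1. int (ds ! (s - 1)))" for k
  define c where "c k = int (xs ! (k - 1)) - 1" for k
  have xb: "1 \<le> xs ! (k - 1)" "xs ! (k - 1) \<le> ds ! (k - 1)" if "1 \<le> k" "k \<le> length ds" for k
    using xs that by (auto simp: indices_def)
  \<comment> \<open>The lower digits together stay below the next place value, so dividing by it
    leaves no carry.\<close>
  have digits: "0 \<le> (\<Sum>k=1..n. c k * P k) \<and> (\<Sum>k=1..n. c k * P k) < P (Suc n)" if "n \<le> length ds" for n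
    using that
  proof (induction n)
    case (Suc n)
    have x: "0 \<le> c (Suc n)" "c (Suc n) + 1 \<le> int (ds ! n)"
      using xb[of "Suc n"] Suc.prems by (simp_all add: c_def)
    have P: "P (Suc (Suc n)) = int (ds ! n) * P (Suc n)" and Pn: "0 \<le> P (Suc n)"
      by (simp_all add: P_def prod_nonneg mult.commute)
    have "(c (Suc n) + 1) * P (Suc n) \<le> P (Suc (Suc n))"
      unfolding P using x Pn by (intro mult_right_mono) auto
    then show ?case using Suc.IH Suc.prems x Pn by (simp add: algebra_simps)
  qed (simp add: P_def)
  have flat: "int (flat_index ds xs) - 1 = (\<Sum>k=1..length ds. c k * P k)"
  proof -
    have "(\<Sum>k=1..length ds. c k * P k) = c 1 * P 1 + (\<Sum>k=2..length ds. c k * P k)"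
      using sum.atLeast_Suc_atMost[of 1 "length ds" "\<lambda>k. c k * P k"] less.prems
      by (simp add: numeral_2_eq_2)
    also have "(\<Sum>k=2..length ds. c k * P k)
        = int (\<Sum>k=2..length ds. (xs ! (k - 1) - 1) * (\<Prod>s=1..k - 1. ds ! (s - 1)))"
      unfolding of_nat_sum using xb
      by (intro sum.cong) (auto simp: c_def P_def of_nat_diff)
    finally show ?thesis by (simp add: flat_index_def c_def P_def)
  qed
  define u where "u = (\<Sum>k=t + 1..length ds. (diag_pos ds (flat_index ds xs) k - 1) * P k)"
  have "u = (\<Sum>k=t + 1..length ds. c k * P k)"
    unfolding u_def using less by (intro sum.cong) (auto simp: c_def)
  \<comment> \<open>Subtracting the higher digits leaves the expansion truncated after digit
    \<open>t\<close>.\<close>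
  then have eq: "int (flat_index ds xs) - 1 - u = (\<Sum>k=1..t. c k * P k)"
    using flat sum.ub_add_nat[of 1 t "\<lambda>k. c k * P k" "length ds - t"] less.prems by simp
  obtain n where n: "t = Suc n" using less.prems by (cases t) auto
  have eq: "int (flat_index ds xs) - 1 - u = (\<Sum>k=1..n. c k * P k) + c t * P t"
    unfolding eq n by simp
  have "diag_pos ds (flat_index ds xs) t
      = (if t = 1 then int (flat_index ds xs) - u else (int (flat_index ds xs) - 1 - u) div P t + 1)"
    unfolding diag_pos.simps[of ds "flat_index ds xs" t] u_def P_def Let_def ..
  also have "\<dots> = c t + 1"
  proof (cases "t = 1")
    case True
    \<comment> \<open>The lowest digit has place value 1, an empty product, and no digits lie below
      it.\<close>
    then show ?thesis using eq n by (simp add: P_def)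
  next
    case False
    have "((\<Sum>k=1..n. c k * P k) + c t * P t) div P t = c t"
      using digits[of n] less.prems n by (simp add: div_pos_pos_trivial)
    then show ?thesis using False eq by simp
  qed
  finally show ?case by (simp add: c_def)
qed

lemma diag_index_flat_index:
  assumes "xs \<in> indices ds"
  shows "diag_index ds (flat_index ds xs) = xs"
  by (rule nth_equalityI)
    (use assms in \<open>simp_all add: diag_index_def diag_pos_flat_index indices_length nth_append del: upt_Suc\<close>)

text \<open>Each such \<open>i\<close> is a value of \<open>flat_index\<close>, so the left inverse
  is a right inverse as well.\<close>

lemma diag_index:
  assumes "ds \<noteq> []" "i \<in> {1..prod_list ds}"
  shows "diag_index ds i \<in> indices ds" "flat_index ds (diag_index ds i) = i"
proof -
  obtain xs where "xs \<in> indices ds" "i = flat_index ds xs"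
    using bij_betw_flat_index[OF assms(1)] assms(2) by (metis bij_betw_imp_surj_on imageE)
  then show "diag_index ds i \<in> indices ds" "flat_index ds (diag_index ds i) = i"
    by (simp_all add: diag_index_flat_index)
qed

lemma inj_on_diag_index: "ds \<noteq> [] \<Longrightarrow> inj_on (diag_index ds) {1..prod_list ds}"
  by (metis diag_index(2) inj_onI)

section \<open>Diagonal tensors and their Moore-Penrose inverses\<close>

text \<open>A sum over \<open>i\<close> avoids choosing the \<open>i\<close> that belongs to a
  position, and turns products into sums that can be exchanged. At most one summand is nonzero when
  the positions are distinct.\<close>

definition diag_tensor ::
  "nat list \<Rightarrow> nat list \<Rightarrow> nat \<Rightarrow> (nat \<Rightarrow> real) \<Rightarrow> nat list \<Rightarrow> quat" where
  "diag_tensor I J r d = (\<lambda>z\<in>indices (I @ J).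
     \<Sum>i=1..r. if z = diag_index I i @ diag_index J i then of_real (d i) else 0)"

lemma diag_tensor_in_tensors [simp]: "diag_tensor I J r d \<in> tensors (I @ J)"
  by (simp add: diag_tensor_def tensors_def)

lemma diag_tensor_entry:
  assumes "x \<in> indices I" "y \<in> indices J"
  shows "diag_tensor I J r d (x @ y)
    = (\<Sum>i=1..r. if x = diag_index I i \<and> y = diag_index J i then of_real (d i) else 0)"
proof -
  \<comment> \<open>Both prefixes have length \<open>length I\<close>, so the equation splits into
    its two halves.\<close>
  have "x @ y = diag_index I i @ diag_index J i \<longleftrightarrow> x = diag_index I i \<and> y = diag_index J i" for i
    using assms(1) by (simp add: diag_index_def indices_length append_eq_append_conv del: upt_Suc)
  then show ?thesis using assms by (simp add: diag_tensor_def append_in_indices indices_length)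
qed

lemma diag_tensor_cong: "(\<And>i. i \<in> {1..r} \<Longrightarrow> d i = e i) \<Longrightarrow> diag_tensor I J r d = diag_tensor I J r e"
  unfolding diag_tensor_def by (intro restrict_cong refl) (auto simp: simp_implies_def intro!: sum.cong)

text \<open>The clauses of \<open>is_diag_tensor\<close> fix every entry, so at most one tensor
  satisfies them. That the explicit sum does so rests on the distinctness of the positions.\<close>

lemma is_diag_tensor_iff:
  assumes "I \<noteq> []" "J \<noteq> []" "r \<le> prod_list I" "r \<le> prod_list J"
  shows "is_diag_tensor I J r d B \<longleftrightarrow> B = diag_tensor I J r d"
proof -
  have on_diag: "diag_tensor I J r e (diag_index I i @ diag_index J i) = of_real (e i)"
    if i: "i \<in> {1..r}" for e i
  proof -
    \<comment> \<open>The first half of the position alone singles out the summand.\<close>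
    have "diag_index I i = diag_index I j \<longleftrightarrow> i = j" if "j \<in> {1..r}" for j
      using inj_on_eq_iff[OF inj_on_diag_index[OF assms(1)], of i j] i that assms(3) by simp
    then have "diag_tensor I J r e (diag_index I i @ diag_index J i)
        = (\<Sum>j=1..r. if i = j then of_real (e j) else 0)"
      using i assms diag_index(1)[of I i] diag_index(1)[of J i]
      by (intro trans[OF diag_tensor_entry] sum.cong) auto
    then show ?thesis using i by simp
  qed
  have off_diag: "diag_tensor I J r e z = 0"
    if "z \<in> indices (I @ J)" "\<forall>i\<in>{1..r}. z \<noteq> diag_index I i @ diag_index J i" for e z
    using that by (simp add: diag_tensor_def)
  show ?thesis
  proof
    assume B: "is_diag_tensor I J r d B"
    show "B = diag_tensor I J r d"
    proof (rule PiE_ext)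
      show "B \<in> indices (I @ J) \<rightarrow>\<^sub>E UNIV" "diag_tensor I J r d \<in> indices (I @ J) \<rightarrow>\<^sub>E UNIV"
        using B diag_tensor_in_tensors by (simp_all add: is_diag_tensor_def flip: tensors_def)
      show "B z = diag_tensor I J r d z" if "z \<in> indices (I @ J)" for z
        using B that on_diag off_diag unfolding is_diag_tensor_def by metis
    qed
  qed (simp add: is_diag_tensor_def on_diag off_diag)
qed

text \<open>Distinctness of the contracted positions \<open>diag_index J i\<close> pairs the i-th
  term of one factor with the i-th term of the other and removes the cross terms.\<close>

lemma einstein_diag_tensor:
  assumes J: "J \<noteq> []" "r \<le> prod_list J"
  shows "einstein I J K (diag_tensor I J r d) (diag_tensor J K r e) = diag_tensor I K r (\<lambda>i. d i * e i)"
proof (rule tensors_eqI)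
  fix x z assume x: "x \<in> indices I" and z: "z \<in> indices K"
  \<comment> \<open>\<open>a\<close> and \<open>b\<close> absorb the conditions on the fixed outer
    indices \<open>x\<close> and \<open>z\<close>; only conditions on the summation index
    \<open>y\<close> remain.\<close>
  define a where "a i = (if x = diag_index I i then of_real (d i) else 0 :: quat)" for i
  define b where "b i = (if z = diag_index K i then of_real (e i) else 0 :: quat)" for i
  have q: "diag_index J i \<in> indices J" if "i \<in> {1..r}" for i
    using diag_index(1) J that by auto
  have inj: "diag_index J i = diag_index J j \<longleftrightarrow> i = j" if "i \<in> {1..r}" "j \<in> {1..r}" for i j
    using inj_on_eq_iff[OF inj_on_diag_index[OF J(1)], of i j] J(2) that by simp
  have "einstein I J K (diag_tensor I J r d) (diag_tensor J K r e) (x @ z)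
      = (\<Sum>y\<in>indices J. (\<Sum>i=1..r. if y = diag_index J i then a i else 0)
          * (\<Sum>j=1..r. if y = diag_index J j then b j else 0))"
    using x z unfolding a_def b_def
    by (auto simp: einstein_entry diag_tensor_entry intro!: sum.cong arg_cong2[where f = "(*)"])
  also have "\<dots> = (\<Sum>y\<in>indices J. \<Sum>i=1..r. if y = diag_index J i
      then a i * (\<Sum>j=1..r. if diag_index J i = diag_index J j then b j else 0) else 0)"
    by (auto simp: sum_distrib_right intro!: sum.cong)
  also have "\<dots> = (\<Sum>i=1..r. \<Sum>y\<in>indices J. if y = diag_index J i
      then a i * (\<Sum>j=1..r. if diag_index J i = diag_index J j then b j else 0) else 0)"
    by (rule sum.swap)
  also have "\<dots> = (\<Sum>i=1..r. a i * (\<Sum>j=1..r. if diag_index J i = diag_index J j then b j else 0))"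
    \<comment> \<open>By \<open>q\<close> the only contributing \<open>y\<close>, namely
      \<open>diag_index J i\<close>, lies in the range of summation.\<close>
    by (intro sum.cong refl) (use q in simp)
  also have "\<dots> = (\<Sum>i=1..r. a i * (\<Sum>j=1..r. if i = j then b j else 0))"
    by (intro sum.cong refl arg_cong2[where f = "(*)"]) (simp only: inj)
  also have "\<dots> = (\<Sum>i=1..r. a i * b i)"
    by (intro sum.cong refl) simp
  also have "\<dots> = diag_tensor I K r (\<lambda>i. d i * e i) (x @ z)"
    using x z by (auto simp: diag_tensor_entry a_def b_def intro!: sum.cong)
  finally show "einstein I J K (diag_tensor I J r d) (diag_tensor J K r e) (x @ z)
      = diag_tensor I K r (\<lambda>i. d i * e i) (x @ z)" .
qed simp_all

text \<open>The entries are real, hence fixed by \<open>qcnj\<close>; only the two halves of each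
  position are exchanged.\<close>

lemma ctrans_diag_tensor: "ctrans I J (diag_tensor I J r d) = diag_tensor J I r d"
  by (rule tensors_eqI[where I = J and J = I])
    (auto simp: ctrans_entry diag_tensor_entry qcnj_sum intro!: sum.cong)

text \<open>All products involved are diagonal, so the first two Penrose equations reduce to
  identities between coefficients. The other two hold because a diagonal tensor with equal row and
  column dimensions is its own conjugate transpose.\<close>

lemma is_moore_penrose_diag_tensor:
  assumes "I \<noteq> []" "J \<noteq> []" "r \<le> prod_list I" "r \<le> prod_list J"
    and "\<And>i. i \<in> {1..r} \<Longrightarrow> d i \<noteq> 0"
  shows "is_moore_penrose I J (diag_tensor I J r d) (diag_tensor J I r (\<lambda>i. inverse (d i)))"
  using assms
  by (auto simp: is_moore_penrose_def einstein_diag_tensor ctrans_diag_tensor intro!: diag_tensor_cong)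

theorem theorem4p1:
  fixes N r :: nat and I J :: "nat list"
    and A U B V :: "nat list \<Rightarrow> quat" and d :: "nat \<Rightarrow> real"
  assumes "N \<ge> 1" "length I = N" "length J = N"
    and "\<forall>n\<in>set I. n \<ge> 1" "\<forall>n\<in>set J. n \<ge> 1"
    and "A \<in> tensors (I @ J)"
    and "r = quat_rank (unfold_tensor I J A)"
    and "positive_singular_values (unfold_tensor I J A) d"
    and "unitary_tensor I U" "unitary_tensor J V"
    and "is_diag_tensor I J r d B"
    and "A = einstein I J J (einstein I I J U B) (ctrans J J V)"
  shows "(\<exists>!X. is_moore_penrose I J A X) \<and>
    (\<exists>!Y. is_moore_penrose I J B Y) \<and>
    moore_penrose I J A =
      einstein J I I (einstein J J I V (moore_penrose I J B)) (ctrans I I U) \<and>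
    is_diag_tensor J I r (\<lambda>i. inverse (d i)) (moore_penrose I J B)"
proof -
  \<comment> \<open>\<open>flat_index\<close> reads the head of a multi-index, so the order has to
    be positive.\<close>
  have ne: "I \<noteq> []" "J \<noteq> []" using assms(1-3) by auto
  \<comment> \<open>The rank bounds are part of \<open>positive_singular_values\<close>; the
    unfolded matrix has \<open>prod_list I\<close> rows and \<open>prod_list J\<close>
    columns.\<close>
  have r: "r \<le> prod_list I" "r \<le> prod_list J" and d: "\<And>i. i \<in> {1..r} \<Longrightarrow> d i > 0"
    using assms(8) unfolding positive_singular_values_def Let_def assms(7)[symmetric]
    by (simp_all add: unfold_tensor_def)
  have B: "B = diag_tensor I J r d"
    using assms(11) is_diag_tensor_iff[OF ne r] by simp
  define Y where "Y = diag_tensor J I r (\<lambda>i. inverse (d i))"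
  have Y: "is_moore_penrose I J B Y"
    unfolding B Y_def using ne r d by (intro is_moore_penrose_diag_tensor) force+
  have X: "is_moore_penrose I J A (einstein J I I (einstein J J I V Y) (ctrans I I U))"
    unfolding assms(12) using is_moore_penrose_unitary_equivalence[OF assms(9,10) Y] .
  \<comment> \<open>The same characterization with the roles of \<open>I\<close> and
    \<open>J\<close> exchanged.\<close>
  have "is_diag_tensor J I r (\<lambda>i. inverse (d i)) Y"
    using is_diag_tensor_iff[OF ne(2,1) r(2,1)] by (simp add: Y_def)
  then show ?thesis
    using X Y by (auto simp: moore_penrose_eqI[OF X] moore_penrose_eqI[OF Y] intro: moore_penrose_unique)
qed

end
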